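(* Let $X$ be a Banach space satisfying at least one of the following: (a) $n(X)=1$; (b) $n(X)>0$ and $X$ has the approximation property; (c) $X$ is finite dimensional. Then $X$ has the BPBop-nu if and only if $X$ is one-dimensional.
   Context: Let $X$ be a Banach space over $\mathbb{K}\in\{\mathbb{R},\mathbb{C}\}$, $\mathcal{L}(X)$ the bounded linear operators on $X$ with operator norm. $\Pi(X)=\{(x,x^* )\in S_X\times S_{X^*}: x^*(x)=1\}$; $v(T)=\sup\{|x^*(Tx)|:(x,x^* )\in\Pi(X)\}$; $n(X)=\inf\{v(T): T\in\mathcal{L}(X),\ \|T\|=1\}$. $X$ has the BPBop-nu if for every $\varepsilon>0$ there is $\eta(\varepsilon)>0$ such that whenever $T\in\mathcal{L}(X)$ with $v(T)=1$ and $(x,x^* )\in\Pi(X)$ satisfy $|x^*(Tx)|>1-\eta(\varepsilon)$, there is $(y,y^* )\in\Pi(X)$ with $|y^*(Ty)|=1$, $\|y-x\|<\varepsilon$ and $\|y^*-x^*\|<\varepsilon$. *)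

theory Defs
  imports "HOL-Analysis.Analysis"
begin

text \<open>A Banach space over K (K = real or complex) is modelled as a real Banach space
  (type class banach) together with a K-scalar multiplication sm that extends the real one
  and is compatible with the norm. For K = real one takes sm = scaleR.\<close>

definition K_banach_structure :: "('k::real_normed_field \<Rightarrow> 'a::banach \<Rightarrow> 'a) \<Rightarrow> bool" where
  "K_banach_structure sm \<longleftrightarrow>
     (\<forall>a b x. sm (a + b) x = sm a x + sm b x) \<and>
     (\<forall>a x y. sm a (x + y) = sm a x + sm a y) \<and>
     (\<forall>a b x. sm a (sm b x) = sm (a * b) x) \<and>
     (\<forall>r x. sm (of_real r) x = r *\<^sub>R x) \<and>
     (\<forall>a x. norm (sm a x) = norm a * norm x)"

definition K_dual :: "('k::real_normed_field \<Rightarrow> 'a::banach \<Rightarrow> 'a) \<Rightarrow> ('a \<Rightarrow> 'k) set" where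
  "K_dual sm = {f. (\<forall>x y. f (x + y) = f x + f y) \<and> (\<forall>c x. f (sm c x) = c * f x) \<and>
                   (\<exists>B. \<forall>x. norm (f x) \<le> B * norm x)}"

definition K_ops :: "('k::real_normed_field \<Rightarrow> 'a::banach \<Rightarrow> 'a) \<Rightarrow> ('a \<Rightarrow> 'a) set" where
  "K_ops sm = {T. (\<forall>x y. T (x + y) = T x + T y) \<and> (\<forall>c x. T (sm c x) = sm c (T x)) \<and>
                  (\<exists>B. \<forall>x. norm (T x) \<le> B * norm x)}"

definition Pi_X :: "('k::real_normed_field \<Rightarrow> 'a::banach \<Rightarrow> 'a) \<Rightarrow> ('a \<times> ('a \<Rightarrow> 'k)) set" where
  "Pi_X sm = {(x, f). norm x = 1 \<and> f \<in> K_dual sm \<and> onorm f = 1 \<and> f x = 1}"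

definition num_radius :: "('k::real_normed_field \<Rightarrow> 'a::banach \<Rightarrow> 'a) \<Rightarrow> ('a \<Rightarrow> 'a) \<Rightarrow> real" where
  "num_radius sm T = Sup {norm (f (T x)) | x f. (x, f) \<in> Pi_X sm}"

definition num_index :: "('k::real_normed_field \<Rightarrow> 'a::banach \<Rightarrow> 'a) \<Rightarrow> real" where
  "num_index sm = Inf {num_radius sm T | T. T \<in> K_ops sm \<and> onorm T = 1}"

definition BPBop_nu :: "('k::real_normed_field \<Rightarrow> 'a::banach \<Rightarrow> 'a) \<Rightarrow> bool" where
  "BPBop_nu sm \<longleftrightarrow>
     (\<forall>\<epsilon>>0. \<exists>\<eta>>0. \<forall>T \<in> K_ops sm. num_radius sm T = 1 \<longrightarrow>
        (\<forall>x f. (x, f) \<in> Pi_X sm \<and> norm (f (T x)) > 1 - \<eta> \<longrightarrow>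
           (\<exists>y g. (y, g) \<in> Pi_X sm \<and> norm (g (T y)) = 1 \<and> norm (y - x) < \<epsilon> \<and>
                  onorm (\<lambda>z. g z - f z) < \<epsilon>)))"

definition in_finite_K_span :: "('k::real_normed_field \<Rightarrow> 'a::banach \<Rightarrow> 'a) \<Rightarrow> 'a set \<Rightarrow> bool" where
  "in_finite_K_span sm S \<longleftrightarrow>
     (\<exists>B. finite B \<and> (\<forall>y \<in> S. \<exists>c. y = (\<Sum>b\<in>B. sm (c b) b)))"

definition K_finite_dimensional :: "('k::real_normed_field \<Rightarrow> 'a::banach \<Rightarrow> 'a) \<Rightarrow> bool" where
  "K_finite_dimensional sm \<longleftrightarrow> in_finite_K_span sm UNIV"

definition K_one_dimensional :: "('k::real_normed_field \<Rightarrow> 'a::banach \<Rightarrow> 'a) \<Rightarrow> bool" where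
  "K_one_dimensional sm \<longleftrightarrow> (\<exists>e. e \<noteq> 0 \<and> (\<forall>y. \<exists>c. y = sm c e))"

definition approximation_property :: "('k::real_normed_field \<Rightarrow> 'a::banach \<Rightarrow> 'a) \<Rightarrow> bool" where
  "approximation_property sm \<longleftrightarrow>
     (\<forall>K. compact K \<longrightarrow> (\<forall>\<epsilon>>0. \<exists>T \<in> K_ops sm. in_finite_K_span sm (range T) \<and>
        (\<forall>x\<in>K. norm (T x - x) < \<epsilon>)))"

end

theory Submission
  imports Defs
begin

text \<open>If \<open>X\<close> is not one-dimensional,
  fix a state \<open>(x\<^sub>0, f\<^sub>0)\<close> and a state \<open>(y\<^sub>1, g\<^sub>1)\<close> with \<open>f\<^sub>0 y\<^sub>1 = 0\<close>, and let
  \<open>T = (I + s f\<^sub>0(\<cdot>) x\<^sub>0) / (1 + s)\<close> with small \<open>s > 0\<close>. Then \<open>v(T) = 1\<close>, and any state \<open>(y, g)\<close>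
  at which \<open>T\<close> attains its numerical radius satisfies \<open>|f\<^sub>0 y| = 1\<close>, hence \<open>\<parallel>y - y\<^sub>1\<parallel> \<ge> 1\<close>; but
  \<open>|g\<^sub>1 (T y\<^sub>1)| = 1 / (1 + s)\<close> is as close to 1 as we like. The states come from the Hahn-Banach theorem,
  proved here through minimal sublinear functionals and transferred to complex scalars via
  \<open>x \<mapsto> g x - \<i> g (\<i> x)\<close>.\<close>

section \<open>Sublinear functionals and their shift along a vector\<close>

definition sublinear :: "('a::real_vector \<Rightarrow> real) \<Rightarrow> bool" where
  "sublinear p \<longleftrightarrow> (\<forall>x y. p (x + y) \<le> p x + p y) \<and> (\<forall>r>0. \<forall>x. p (r *\<^sub>R x) = r * p x)"

text \<open>Applying \<open>scale\<close> with the factor \<open>inverse r\<close> to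
  \<open>r *\<^sub>R x\<close> gives the reverse inequality, so one direction suffices.\<close>

lemma sublinearI:
  assumes add: "\<And>x y. p (x + y) \<le> p x + p y"
    and scale: "\<And>r x. r > 0 \<Longrightarrow> p (r *\<^sub>R x) \<le> r * p x"
  shows "sublinear p"
  unfolding sublinear_def
proof (intro conjI allI impI antisym)
  fix r :: real and x assume r: "r > 0"
  show "p (r *\<^sub>R x) \<le> r * p x" by (rule scale[OF r])
  have "p (inverse r *\<^sub>R (r *\<^sub>R x)) \<le> inverse r * p (r *\<^sub>R x)" using r by (intro scale) simp
  then show "r * p x \<le> p (r *\<^sub>R x)" using r by (simp add: field_simps)
qed (rule add)

lemma sublinear_add: "sublinear p \<Longrightarrow> p (x + y) \<le> p x + p y"
  by (simp add: sublinear_def)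

lemma sublinear_scale: "sublinear p \<Longrightarrow> r > 0 \<Longrightarrow> p (r *\<^sub>R x) = r * p x"
  by (simp add: sublinear_def)

lemma sublinear_zero: "sublinear p \<Longrightarrow> p 0 = 0"
  using sublinear_scale[of p 2 0] by simp

lemma sublinear_minus: "sublinear p \<Longrightarrow> - p (- x) \<le> p x"
  using sublinear_add[of p x "- x"] sublinear_zero[of p] by simp

lemma sublinear_norm: "sublinear norm"
  by (rule sublinearI) (auto simp: norm_triangle_ineq)

text \<open>The classical auxiliary functional of Hahn-Banach proofs: for sublinear \<open>p\<close>
  it is sublinear, lies below \<open>p\<close>, and at \<open>- a\<close> is at most
  \<open>- p a\<close> (take \<open>t = 1\<close>), so a linear minorant must reach at least
  \<open>p a\<close> at \<open>a\<close>.\<close>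

definition sublinear_shift :: "('a::real_vector \<Rightarrow> real) \<Rightarrow> 'a \<Rightarrow> 'a \<Rightarrow> real" where
  "sublinear_shift p a x = (INF t\<in>{0..}. p (x + t *\<^sub>R a) - t * p a)"

lemma sublinear_shift_le:
  assumes p: "sublinear p" and t: "t \<ge> 0"
  shows "sublinear_shift p a x \<le> p (x + t *\<^sub>R a) - t * p a"
  unfolding sublinear_shift_def
proof (rule cINF_lower)
  show "bdd_below ((\<lambda>t. p (x + t *\<^sub>R a) - t * p a) ` {0..})"
  \<comment> \<open>The bound is uniform in \<open>t\<close>: split \<open>t *\<^sub>R a\<close> as
    \<open>(x + t *\<^sub>R a) + (- x)\<close>.\<close>
  proof (rule bdd_belowI2[of _ "- p (- x)"])
    fix t :: real assume "t \<in> {0..}"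
    then have "p (t *\<^sub>R a) = t * p a"
      using sublinear_scale[OF p] sublinear_zero[OF p] by (cases "t = 0") auto
    moreover have "p (t *\<^sub>R a) \<le> p (x + t *\<^sub>R a) + p (- x)"
      using sublinear_add[OF p, of "x + t *\<^sub>R a" "- x"] by simp
    ultimately show "- p (- x) \<le> p (x + t *\<^sub>R a) - t * p a" by simp
  qed
qed (use t in simp)

lemma sublinear_shift_greatest:
  assumes "\<And>t. t \<ge> 0 \<Longrightarrow> c \<le> p (x + t *\<^sub>R a) - t * p a"
  shows "c \<le> sublinear_shift p a x"
  unfolding sublinear_shift_def using assms by (intro cINF_greatest) auto

lemma sublinear_shift_self_le: "sublinear p \<Longrightarrow> sublinear_shift p a x \<le> p x"
  using sublinear_shift_le[of p 0] by simp

text \<open>Parameters \<open>t\<close> for \<open>x\<close> and \<open>s\<close> for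
  \<open>y\<close> combine to \<open>t + s\<close> for \<open>x + y\<close>; the two infima are then
  taken one after the other. For scaling, \<open>t\<close> is replaced by
  \<open>r * t\<close>.\<close>

lemma sublinear_sublinear_shift:
  assumes p: "sublinear p"
  shows "sublinear (sublinear_shift p a)"
proof (rule sublinearI)
  fix x y
  have *: "sublinear_shift p a (x + y) \<le> (p (x + t *\<^sub>R a) - t * p a) + (p (y + s *\<^sub>R a) - s * p a)"
    if "t \<ge> 0" "s \<ge> 0" for s t
  proof -
    have "sublinear_shift p a (x + y) \<le> p ((x + y) + (t + s) *\<^sub>R a) - (t + s) * p a"
      using that by (intro sublinear_shift_le[OF p]) simp
    moreover have "p ((x + y) + (t + s) *\<^sub>R a) \<le> p (x + t *\<^sub>R a) + p (y + s *\<^sub>R a)"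
      using sublinear_add[OF p, of "x + t *\<^sub>R a" "y + s *\<^sub>R a"] by (simp add: algebra_simps)
    ultimately show ?thesis by (simp add: algebra_simps)
  qed
  have "sublinear_shift p a (x + y) - (p (y + s *\<^sub>R a) - s * p a) \<le> sublinear_shift p a x"
    if "s \<ge> 0" for s
  proof (rule sublinear_shift_greatest)
    fix t :: real assume "t \<ge> 0"
    from *[OF this that] show "sublinear_shift p a (x + y) - (p (y + s *\<^sub>R a) - s * p a)
        \<le> p (x + t *\<^sub>R a) - t * p a" by linarith
  qed
  then have "sublinear_shift p a (x + y) - sublinear_shift p a x \<le> sublinear_shift p a y"
    by (intro sublinear_shift_greatest) (simp add: algebra_simps)
  then show "sublinear_shift p a (x + y) \<le> sublinear_shift p a x + sublinear_shift p a y"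
    by linarith
next
  fix r :: real and x assume r: "r > 0"
  have "inverse r * sublinear_shift p a (r *\<^sub>R x) \<le> sublinear_shift p a x"
  proof (rule sublinear_shift_greatest)
    fix t :: real assume t: "t \<ge> 0"
    have "sublinear_shift p a (r *\<^sub>R x) \<le> p (r *\<^sub>R x + (r * t) *\<^sub>R a) - r * t * p a"
      using r t by (intro sublinear_shift_le[OF p]) simp
    also have "p (r *\<^sub>R x + (r * t) *\<^sub>R a) = r * p (x + t *\<^sub>R a)"
      using sublinear_scale[OF p r, of "x + t *\<^sub>R a"] by (simp add: scaleR_right_distrib)
    finally show "inverse r * sublinear_shift p a (r *\<^sub>R x) \<le> p (x + t *\<^sub>R a) - t * p a"
      using r by (simp add: field_simps)
  qed
  then show "sublinear_shift p a (r *\<^sub>R x) \<le> r * sublinear_shift p a x"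
    using r by (simp add: field_simps)
qed

section \<open>Hahn-Banach theorem via minimal sublinear functionals\<close>

text \<open>Zorn's lemma for the reversed pointwise order: the pointwise infimum of a nonempty chain
  is again sublinear.\<close>

lemma ex_minimal_sublinear:
  assumes q: "sublinear q"
  obtains p where "sublinear p" "p \<le> q" "\<And>p'. sublinear p' \<Longrightarrow> p' \<le> p \<Longrightarrow> p' = p"
proof -
  define A where "A = {p. sublinear p \<and> p \<le> q}"
  have "\<exists>m\<in>A. \<forall>a\<in>A. a \<le> m \<longrightarrow> a = m"
  proof (rule predicate_Zorn)
    show "partial_order_on A (relation_of (\<lambda>p p'. p' \<le> p) A)"
      by (rule partial_order_on_relation_ofI) auto
  next
    fix C assume "C \<in> Chains (relation_of (\<lambda>p p'. p' \<le> p) A)"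
    then have CA: "C \<subseteq> A" and total: "\<And>p p'. p \<in> C \<Longrightarrow> p' \<in> C \<Longrightarrow> p \<le> p' \<or> p' \<le> p"
      by (auto simp: Chains_def relation_of_def)
    show "\<exists>u\<in>A. \<forall>p\<in>C. u \<le> p"
    proof (cases "C = {}")
      case True
      then show ?thesis using q by (auto simp: A_def)
    next
      case False
      define u where "u x = (INF p\<in>C. p x)" for x
      have sub: "sublinear p" "p x \<le> q x" if "p \<in> C" for p x
        using that CA by (auto simp: A_def le_fun_def)
      have u_le: "u x \<le> p x" if "p \<in> C" for p x
        unfolding u_def
      \<comment> \<open>All members share this bound, since
        \<open>- q (- x) \<le> - p (- x) \<le> p x\<close>.\<close>
      proof (rule cINF_lower[OF bdd_belowI2[of _ "- q (- x)"] that])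
        fix p assume "p \<in> C"
        with sublinear_minus[of p x] sub(1)[of p] sub(2)[of p "- x"] show "- q (- x) \<le> p x" by force
      qed
      have le_u: "c \<le> u x" if "\<And>p. p \<in> C \<Longrightarrow> c \<le> p x" for c x
        unfolding u_def using that False by (intro cINF_greatest) auto
      have "sublinear u"
      proof (rule sublinearI)
        fix x y
        have *: "u (x + y) \<le> p x + p' y" if pp: "p \<in> C" "p' \<in> C" for p p'
        proof -
          \<comment> \<open>Different members may be nearly optimal at \<open>x\<close> and at
            \<open>y\<close>; in a chain the smaller of the two serves both.\<close>
          obtain p'' where "p'' \<in> C" "p'' \<le> p" "p'' \<le> p'" using total[OF pp] pp by blast
          then have "u (x + y) \<le> p'' x + p'' y" "p'' x \<le> p x" "p'' y \<le> p' y"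
            using u_le[of p'' "x + y"] sublinear_add[of p'' x y] sub(1)[of p'']
            by (auto simp: le_fun_def)
          then show ?thesis by linarith
        qed
        have "u (x + y) - p' y \<le> u x" if "p' \<in> C" for p'
          using *[OF _ that] by (intro le_u) (simp add: algebra_simps)
        then have "u (x + y) - u x \<le> u y"
          by (intro le_u) (simp add: algebra_simps)
        then show "u (x + y) \<le> u x + u y" by linarith
      next
        fix r :: real and x assume r: "r > 0"
        have "inverse r * u (r *\<^sub>R x) \<le> u x"
        proof (rule le_u)
          fix p assume "p \<in> C"
          then have "u (r *\<^sub>R x) \<le> r * p x"
            using u_le[of p "r *\<^sub>R x"] sublinear_scale[OF sub(1) r] by simp
          then show "inverse r * u (r *\<^sub>R x) \<le> p x" using r by (simp add: field_simps)
        qed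
        then show "u (r *\<^sub>R x) \<le> r * u x" using r by (simp add: field_simps)
      qed
      moreover have "u \<le> q"
        using False u_le sub(2) by (fastforce simp: le_fun_def intro: order_trans)
      ultimately have "u \<in> A" by (simp add: A_def)
      then show ?thesis using u_le by (auto simp: le_fun_def)
    qed
  qed
  then obtain m where m: "m \<in> A" "\<And>a. a \<in> A \<Longrightarrow> a \<le> m \<Longrightarrow> a = m" by blast
  show ?thesis
  proof (rule that[of m])
    show "sublinear m" "m \<le> q" using m(1) by (auto simp: A_def)
    show "p' = m" if "sublinear p'" "p' \<le> m" for p'
      using that m(1) by (intro m(2)) (auto simp: A_def)
  qed
qed

text \<open>A minimal \<open>p\<close> below \<open>q\<close> is itself linear: its shift along any
  \<open>a\<close> is sublinear and below \<open>p\<close>, hence equal to \<open>p\<close>, and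
  \<open>t = 1\<close> gives superadditivity.\<close>

lemma hahn_banach_sublinear:
  assumes "sublinear q"
  obtains g where "linear g" "\<And>x. g x \<le> q x"
proof -
  obtain p where p: "sublinear p" and pq: "p \<le> q"
    and min: "\<And>p'. sublinear p' \<Longrightarrow> p' \<le> p \<Longrightarrow> p' = p"
    using ex_minimal_sublinear[OF assms] by blast
  have add: "p (x + a) = p x + p a" for x a
  proof (rule antisym[OF sublinear_add[OF p]])
    have "sublinear_shift p a = p"
      using p by (intro min le_funI sublinear_sublinear_shift sublinear_shift_self_le)
    then show "p x + p a \<le> p (x + a)"
      using sublinear_shift_le[OF p, of 1 a x] by simp
  qed
  have minus: "p (- x) = - p x" for x
    using add[of x "- x"] sublinear_zero[OF p] by simp
  have "p (r *\<^sub>R x) = r * p x" for r x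
  proof (cases r "0::real" rule: linorder_cases)
    case less
    then show ?thesis using sublinear_scale[OF p, of "- r" x] minus[of "r *\<^sub>R x"] by simp
  qed (use sublinear_scale[OF p] sublinear_zero[OF p] in auto)
  then have "linear p" using add by (intro linearI) auto
  with pq that[of p] show ?thesis by (auto simp: le_fun_def)
qed

text \<open>Dominating by the shift of the norm along \<open>y\<close>, rather than by the norm,
  also forces \<open>g (- y) \<le> - norm y\<close>; this fixes the value at \<open>y\<close>
  without extending from a subspace.\<close>

lemma ex_norming_functional:
  fixes y :: "'a::real_normed_vector"
  obtains g where "linear g" "\<And>x. \<bar>g x\<bar> \<le> norm x" "g y = norm y"
proof -
  obtain g where g: "linear g" and le: "\<And>x. g x \<le> sublinear_shift norm y x"
    using hahn_banach_sublinear[OF sublinear_sublinear_shift[OF sublinear_norm]] by blast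
  have ub: "g x \<le> norm x" for x
    using le[of x] sublinear_shift_self_le[OF sublinear_norm, of y x] by linarith
  have abs: "\<bar>g x\<bar> \<le> norm x" for x
    using ub[of x] ub[of "- x"] by (simp add: linear_neg[OF g])
  have "g (- y) \<le> - norm y"
    using le[of "- y"] sublinear_shift_le[OF sublinear_norm, of 1 y "- y"] by simp
  then have "g y = norm y" using ub[of y] by (simp add: linear_neg[OF g])
  with g abs that show ?thesis by blast
qed

section \<open>Existence and contractivity of states\<close>

lemma onorm_eq_1I:
  assumes le: "\<And>x. norm (f x) \<le> norm x" and "norm y = 1" "norm (f y) = 1"
  shows "onorm f = 1"
proof (rule antisym)
  show "onorm f \<le> 1" using le by (intro onorm_bound) auto
  \<comment> \<open>\<open>onorm\<close> is a supremum of quotients; they are all at most 1, the one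
    at the zero vector being 0 by the convention for division by zero.\<close>
  have "norm (f y) / norm y \<le> (SUP x. norm (f x) / norm x)"
    using le by (intro cSUP_upper bdd_aboveI2[where M = 1]) (auto simp: divide_le_eq_1)
  then show "1 \<le> onorm f" using assms by (simp add: onorm_def)
qed

lemma ex_state_real:
  fixes y :: "'a::banach"
  assumes "norm y = 1"
  shows "\<exists>g. (y, g) \<in> Pi_X ((*\<^sub>R) :: real \<Rightarrow> 'a \<Rightarrow> 'a)"
proof -
  obtain g where g: "linear g" "\<And>x. \<bar>g x\<bar> \<le> norm x" "g y = norm y"
    using ex_norming_functional[of y] by blast
  have "onorm g = 1" by (rule onorm_eq_1I[of g y]) (use g assms in auto)
  moreover have "g \<in> K_dual ((*\<^sub>R) :: real \<Rightarrow> 'a \<Rightarrow> 'a)"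
    using g(2) by (auto simp: K_dual_def linear_add[OF g(1)] linear_cmul[OF g(1)] intro!: exI[of _ 1])
  ultimately show ?thesis using assms g(3) by (auto simp: Pi_X_def)
qed

lemma ex_state_complex:
  fixes sm :: "complex \<Rightarrow> 'a::banach \<Rightarrow> 'a"
  assumes sm: "K_banach_structure sm" and y: "norm y = 1"
  shows "\<exists>g. (y, g) \<in> Pi_X sm"
proof -
  obtain g where g: "linear g" "\<And>x. \<bar>g x\<bar> \<le> norm x" "g y = norm y"
    using ex_norming_functional[of y] by blast
  have sm_add: "sm (a + b) x = sm a x + sm b x" "sm a (x + x') = sm a x + sm a x'"
    and sm_mult: "sm a (sm b x) = sm (a * b) x" and sm_real: "sm (of_real r) x = r *\<^sub>R x"
    and sm_norm: "norm (sm a x) = norm a * norm x" for a b x x' r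
    using sm by (auto simp: K_banach_structure_def)
  \<comment> \<open>The complex functional with real part \<open>g\<close>; the minus sign makes it
    commute with multiplication by \<open>\<i>\<close>.\<close>
  define h where "h x = Complex (g x) (- g (sm \<i> x))" for x
  have h_add: "h (x + x') = h x + h x'" for x x'
    by (simp add: h_def sm_add linear_add[OF g(1)] complex_eq_iff)
  have sm_cplx: "sm c x = Re c *\<^sub>R x + Im c *\<^sub>R sm \<i> x" for c x
  proof -
    have "sm c x = sm (of_real (Re c) + of_real (Im c) * \<i>) x"
      by (subst complex_eq[of c]) (simp add: mult.commute)
    also have "\<dots> = Re c *\<^sub>R x + Im c *\<^sub>R sm \<i> x"
      by (simp only: sm_add sm_mult[symmetric] sm_real)
    finally show ?thesis .
  qed
  have ii: "sm \<i> (sm \<i> x) = - x" for x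
    using sm_real[of "- 1" x] by (simp add: sm_mult)
  have sm_scale: "sm \<i> (r *\<^sub>R x) = r *\<^sub>R sm \<i> x" for r x
    by (simp add: sm_real[symmetric] sm_mult mult.commute)
  have h_scale: "h (sm c x) = c * h x" for c x
    by (simp add: h_def sm_cplx[of c x] sm_add sm_scale ii linear_add[OF g(1)] linear_neg[OF g(1)]
        linear_diff[OF g(1)] linear_cmul[OF g(1)] complex_eq_iff algebra_simps)
  have h_le: "norm (h x) \<le> norm x" for x
  proof -
    \<comment> \<open>rotate \<open>x\<close> so that \<open>h\<close> becomes real and equals \<open>g\<close>\<close>
    define c where "c = cnj (sgn (h x))"
    have "c * h x = of_real (norm (h x))"
      by (simp add: c_def sgn_eq mult.commute complex_norm_square[symmetric] power2_eq_square)
    then have "norm (h x) = g (sm c x)"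
      by (metis Re_complex_of_real complex.sel(1) h_def h_scale)
    also have "\<dots> \<le> norm c * norm x" using g(2)[of "sm c x"] sm_norm[of c x] by linarith
    also have "\<dots> \<le> norm x" by (simp add: c_def norm_sgn)
    finally show ?thesis .
  qed
  have hy: "h y = 1"
  proof -
    \<comment> \<open>The real part of \<open>h y\<close> is already 1, so modulus at most 1 leaves
      no imaginary part.\<close>
    have "(Re (h y))\<^sup>2 + (Im (h y))\<^sup>2 \<le> 1"
      using power_mono[OF h_le[of y], of 2] y by (simp add: cmod_power2)
    then show ?thesis using g(3) y by (simp add: h_def complex_eq_iff)
  qed
  have "onorm h = 1" by (rule onorm_eq_1I[of h y]) (use h_le hy y in auto)
  moreover have "h \<in> K_dual sm"
    using h_add h_scale h_le by (auto simp: K_dual_def intro!: exI[of _ 1])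
  ultimately show ?thesis using y hy by (auto simp: Pi_X_def)
qed

text \<open>The library bound for \<open>onorm\<close> asks for a bounded real-linear map; real
  homogeneity comes from the scalars \<open>of_real r\<close>, which act through \<open>sm\<close>
  as real scaling.\<close>

lemma norm_state_le:
  fixes sm :: "'k::real_normed_field \<Rightarrow> 'a::banach \<Rightarrow> 'a"
  assumes sm: "K_banach_structure sm" and "(x, f) \<in> Pi_X sm"
  shows "norm (f z) \<le> norm z"
proof -
  have f: "f \<in> K_dual sm" "onorm f = 1" using assms by (auto simp: Pi_X_def)
  have "f (r *\<^sub>R z) = r *\<^sub>R f z" for r z
    using f sm by (auto simp: K_dual_def K_banach_structure_def scaleR_conv_of_real) metis
  moreover obtain B where "\<And>z. norm (f z) \<le> norm z * B"
    using f by (auto simp: K_dual_def mult.commute)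
  ultimately have "bounded_linear f"
    using f by (intro bounded_linear_intro) (auto simp: K_dual_def)
  from onorm[OF this, of z] f show ?thesis by simp
qed

section \<open>The property in dimension one\<close>

text \<open>Every operator is multiplication by some \<open>c\<close>, so all states give the same
  value \<open>norm c\<close>. Numerical radius 1 makes it 1, and the given state needs no
  change.\<close>

lemma BPBop_nu_one_dimensional:
  fixes sm :: "'k::real_normed_field \<Rightarrow> 'a::banach \<Rightarrow> 'a"
  assumes sm: "K_banach_structure sm" and one: "K_one_dimensional sm"
  shows "BPBop_nu sm"
  unfolding BPBop_nu_def
proof (intro allI impI exI[of _ 1] conjI ballI)
  fix \<epsilon> :: real and T x f
  assume \<epsilon>: "\<epsilon> > 0" and T: "T \<in> K_ops sm" and v: "num_radius sm T = 1"
    and xf: "(x, f) \<in> Pi_X sm \<and> norm (f (T x)) > 1 - 1"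
  obtain e where e: "\<And>y. \<exists>c. y = sm c e" using one by (auto simp: K_one_dimensional_def)
  obtain c where c: "T e = sm c e" using e by blast
  have Tc: "T y = sm c y" for y
  proof -
    obtain a where "y = sm a e" using e by blast
    then show ?thesis
      using T sm c by (simp add: K_ops_def K_banach_structure_def mult.commute)
  qed
  have state: "norm (g (T y)) = norm c" if "(y, g) \<in> Pi_X sm" for y g
    using that by (simp add: Tc Pi_X_def K_dual_def)
  \<comment> \<open>The state \<open>(x, f)\<close> keeps this set from being empty.\<close>
  have "{norm (g (T y)) | y g. (y, g) \<in> Pi_X sm} = {norm c}"
    using state xf by auto metis
  then have "norm c = 1" using v by (simp add: num_radius_def)
  then show "\<exists>y g. (y, g) \<in> Pi_X sm \<and> norm (g (T y)) = 1 \<and> norm (y - x) < \<epsilon> \<and>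
      onorm (\<lambda>z. g z - f z) < \<epsilon>"
    using xf state \<epsilon> by (intro exI[of _ x] exI[of _ f]) (auto simp: onorm_zero)
qed simp

section \<open>Failure of the property beyond dimension one\<close>

text \<open>Hahn-Banach enters only through \<open>state\<close>, so one argument covers both scalar
  fields. \<open>nz\<close> excludes the zero space, which has no states and satisfies
  \<open>BPBop_nu\<close> vacuously.\<close>

lemma one_dimensional_BPBop_nu:
  fixes sm :: "'k::real_normed_field \<Rightarrow> 'a::banach \<Rightarrow> 'a"
  assumes sm: "K_banach_structure sm" and nz: "\<exists>x::'a. x \<noteq> 0"
    and state: "\<And>y. norm y = 1 \<Longrightarrow> \<exists>g. (y, g) \<in> Pi_X sm"
    and bpb: "BPBop_nu sm"
  shows "K_one_dimensional sm"
proof (rule ccontr)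
  assume not_one: "\<not> K_one_dimensional sm"
  have sm_add: "sm (a + b) x = sm a x + sm b x" "sm a (x + x') = sm a x + sm a x'"
    and sm_mult: "sm a (sm b x) = sm (a * b) x" and sm_real: "sm (of_real r) x = r *\<^sub>R x"
    and sm_norm: "norm (sm a x) = norm a * norm x" for a b x x' r
    using sm by (auto simp: K_banach_structure_def)
  have sm_scale: "sm a (r *\<^sub>R x) = r *\<^sub>R sm a x" "sm (r *\<^sub>R a) x = r *\<^sub>R sm a x" for a r x
    by (simp_all add: sm_real[symmetric] sm_mult mult.commute scaleR_conv_of_real)
  have unit: "norm (x /\<^sub>R norm x) = 1" if "x \<noteq> 0" for x :: 'a
    using that by simp
  obtain x\<^sub>0 f\<^sub>0 where s0: "(x\<^sub>0, f\<^sub>0) \<in> Pi_X sm" using nz unit state by blast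
  then have x0: "norm x\<^sub>0 = 1" "f\<^sub>0 x\<^sub>0 = 1" and f0: "f\<^sub>0 \<in> K_dual sm"
    by (auto simp: Pi_X_def)
  have f0_lin: "f\<^sub>0 (x + y) = f\<^sub>0 x + f\<^sub>0 y" "f\<^sub>0 (sm c x) = c * f\<^sub>0 x" for x y c
    using f0 by (auto simp: K_dual_def)
  have f0_scale: "f\<^sub>0 (r *\<^sub>R x) = r *\<^sub>R f\<^sub>0 x" for r x
    by (simp add: sm_real[symmetric] f0_lin scaleR_conv_of_real)
  have "x\<^sub>0 \<noteq> 0" using x0 by auto
  then obtain z where z: "z \<noteq> sm (f\<^sub>0 z) x\<^sub>0" using not_one by (auto simp: K_one_dimensional_def)
  \<comment> \<open>The component of \<open>z\<close> in the kernel of \<open>f\<^sub>0\<close>,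
    nonzero by the choice of \<open>z\<close>.\<close>
  define w where "w = z + (- 1) *\<^sub>R sm (f\<^sub>0 z) x\<^sub>0"
  have "w \<noteq> 0" using z by (simp add: w_def)
  moreover have "f\<^sub>0 w = 0"
    unfolding w_def by (simp only: f0_lin f0_scale) (simp add: x0)
  ultimately obtain y\<^sub>1 where y1: "norm y\<^sub>1 = 1" "f\<^sub>0 y\<^sub>1 = 0"
    using that[of "w /\<^sub>R norm w"] unit[of w] by (simp add: f0_scale)
  obtain g\<^sub>1 where s1: "(y\<^sub>1, g\<^sub>1) \<in> Pi_X sm" using state y1 by blast

  \<comment> \<open>\<open>s\<close> is the tolerance belonging to \<epsilon> = 1. It also serves as
    the size of the perturbation in \<open>T\<close>, because
    \<open>1 / (1 + s) > 1 - s\<close>.\<close>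
  obtain s where s: "s > 0" and bpb': "\<And>T x f. T \<in> K_ops sm \<Longrightarrow> num_radius sm T = 1 \<Longrightarrow>
      (x, f) \<in> Pi_X sm \<Longrightarrow> norm (f (T x)) > 1 - s \<Longrightarrow>
      \<exists>y g. (y, g) \<in> Pi_X sm \<and> norm (g (T y)) = 1 \<and> norm (y - x) < 1 \<and>
        onorm (\<lambda>z. g z - f z) < 1"
    using bpb[unfolded BPBop_nu_def, rule_format, OF zero_less_one] by blast
  define T where "T y = (1 / (1 + s)) *\<^sub>R (y + s *\<^sub>R sm (f\<^sub>0 y) x\<^sub>0)" for y

  have gT: "g (T y) = (1 / (1 + s)) *\<^sub>R (1 + s *\<^sub>R (f\<^sub>0 y * g x\<^sub>0))" if "(y, g) \<in> Pi_X sm" for y g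
  proof -
    have g: "g (x + y) = g x + g y" "g (sm c x) = c * g x" for x y c
      using that by (auto simp: Pi_X_def K_dual_def)
    have "g (r *\<^sub>R x) = r *\<^sub>R g x" for r x
      by (simp add: sm_real[symmetric] g scaleR_conv_of_real)
    then show ?thesis using that by (simp add: T_def g Pi_X_def)
  qed
  have f0_le: "norm (f\<^sub>0 y) \<le> norm y" for y by (rule norm_state_le[OF sm s0])
  \<comment> \<open>This estimate does double duty: it bounds the numerical radius by 1, and
    equality to 1 at a state forces \<open>norm (f\<^sub>0 y) \<ge> 1\<close>.\<close>
  have gT_le: "norm (g (T y)) \<le> (1 + s * norm (f\<^sub>0 y)) / (1 + s)" if "(y, g) \<in> Pi_X sm" for y g
  proof -
    have "norm (g x\<^sub>0) \<le> 1" using norm_state_le[OF sm that, of x\<^sub>0] x0 by simp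
    then have "norm (f\<^sub>0 y * g x\<^sub>0) \<le> norm (f\<^sub>0 y)"
      by (simp add: norm_mult mult_left_le)
    then have "norm (1 + s *\<^sub>R (f\<^sub>0 y * g x\<^sub>0)) \<le> 1 + s * norm (f\<^sub>0 y)"
      using s norm_triangle_ineq[of 1 "s *\<^sub>R (f\<^sub>0 y * g x\<^sub>0)"]
      by (smt (verit) mult_left_mono norm_one norm_scaleR)
    then show ?thesis using s by (simp add: gT[OF that] divide_right_mono)
  qed
  have "T \<in> K_ops sm"
  proof -
    have "norm (T y) \<le> 1 * norm y" for y
    proof -
      have "norm (y + s *\<^sub>R sm (f\<^sub>0 y) x\<^sub>0) \<le> norm y + s * norm (f\<^sub>0 y)"
        using norm_triangle_ineq[of y "s *\<^sub>R sm (f\<^sub>0 y) x\<^sub>0"] s x0 by (simp add: sm_norm)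
      also have "\<dots> \<le> (1 + s) * norm y"
        using f0_le[of y] s by (simp add: algebra_simps)
      finally show ?thesis
        using s unfolding T_def norm_scaleR by (simp add: divide_le_eq mult.commute)
    qed
    moreover have "T (x + y) = T x + T y" "T (sm c x) = sm c (T x)" for x y c
      by (simp_all add: T_def f0_lin sm_add sm_scale sm_mult algebra_simps)
    ultimately show ?thesis unfolding K_ops_def by blast
  qed
  moreover have "num_radius sm T = 1"
    unfolding num_radius_def
  \<comment> \<open>The supremum is attained at \<open>(x\<^sub>0, f\<^sub>0)\<close>.\<close>
  proof (rule cSup_eq_maximum)
    have "f\<^sub>0 (T x\<^sub>0) = (1 / (1 + s)) *\<^sub>R ((1 + s) *\<^sub>R 1)"
      unfolding gT[OF s0] by (simp add: x0 scaleR_left_distrib)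
    also have "\<dots> = 1" using s by simp
    finally have "f\<^sub>0 (T x\<^sub>0) = 1" .
    then show "1 \<in> {norm (f (T x)) |x f. (x, f) \<in> Pi_X sm}" using s0 by force
    fix v assume "v \<in> {norm (f (T x)) |x f. (x, f) \<in> Pi_X sm}"
    then obtain y g where yg: "(y, g) \<in> Pi_X sm" and v: "v = norm (g (T y))" by auto
    have "norm (f\<^sub>0 y) \<le> 1" using f0_le[of y] yg by (simp add: Pi_X_def)
    then have "(1 + s * norm (f\<^sub>0 y)) / (1 + s) \<le> 1" using s by (simp add: mult_left_le)
    then show "v \<le> 1" using gT_le[OF yg] v by linarith
  qed
  moreover have "norm (g\<^sub>1 (T y\<^sub>1)) > 1 - s"
  proof -
    have "norm (g\<^sub>1 (T y\<^sub>1)) = 1 / (1 + s)" using s by (simp add: gT[OF s1] y1)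
    also have "1 / (1 + s) > 1 - s" using s by (simp add: field_simps)
    finally show ?thesis .
  qed
  ultimately obtain y g where yg: "(y, g) \<in> Pi_X sm" "norm (g (T y)) = 1" "norm (y - y\<^sub>1) < 1"
    using bpb' s1 by blast
  have "1 + s \<le> 1 + s * norm (f\<^sub>0 y)" using gT_le[OF yg(1)] yg(2) s by (simp add: field_simps)
  then have "1 \<le> norm (f\<^sub>0 y)" using s by simp
  \<comment> \<open>As \<open>f\<^sub>0\<close> vanishes at \<open>y\<^sub>1\<close> and is
    contractive, \<open>y\<close> lies at distance at least 1 from \<open>y\<^sub>1\<close>, against
    the choice of \<epsilon>.\<close>
  also have "f\<^sub>0 y = f\<^sub>0 (y - y\<^sub>1)" using f0_lin(1)[of "y - y\<^sub>1" y\<^sub>1] y1 by simp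
  also have "norm \<dots> \<le> norm (y - y\<^sub>1)" by (rule f0_le)
  finally show False using yg by simp
qed

section \<open>The real and the complex case\<close>

lemma K_banach_structure_scaleR: "K_banach_structure ((*\<^sub>R) :: real \<Rightarrow> 'a::banach \<Rightarrow> 'a)"
  by (simp add: K_banach_structure_def algebra_simps)

text \<open>Both scalar fields use the same two implications and differ only in the lemma supplying
  states.\<close>

theorem theorem2p4:
  shows
  "((\<exists>x::'a::banach. x \<noteq> 0) \<and>
      (num_index ((*\<^sub>R) :: real \<Rightarrow> 'a \<Rightarrow> 'a) = 1 \<or>
       (num_index ((*\<^sub>R) :: real \<Rightarrow> 'a \<Rightarrow> 'a) > 0 \<and>
          approximation_property ((*\<^sub>R) :: real \<Rightarrow> 'a \<Rightarrow> 'a)) \<or>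
       K_finite_dimensional ((*\<^sub>R) :: real \<Rightarrow> 'a \<Rightarrow> 'a))
    \<longrightarrow> (BPBop_nu ((*\<^sub>R) :: real \<Rightarrow> 'a \<Rightarrow> 'a) \<longleftrightarrow>
         K_one_dimensional ((*\<^sub>R) :: real \<Rightarrow> 'a \<Rightarrow> 'a)))
   \<and>
   (\<forall>sm :: complex \<Rightarrow> 'a \<Rightarrow> 'a. K_banach_structure sm \<longrightarrow>
      (\<exists>x::'a::banach. x \<noteq> 0) \<and>
      (num_index sm = 1 \<or> (num_index sm > 0 \<and> approximation_property sm) \<or>
       K_finite_dimensional sm)
    \<longrightarrow> (BPBop_nu sm \<longleftrightarrow> K_one_dimensional sm))"
proof (intro conjI allI impI iffI; (elim conjE)?)
  show "K_one_dimensional ((*\<^sub>R) :: real \<Rightarrow> 'a \<Rightarrow> 'a)"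
    if "\<exists>x::'a. x \<noteq> 0" "BPBop_nu ((*\<^sub>R) :: real \<Rightarrow> 'a \<Rightarrow> 'a)"
    using one_dimensional_BPBop_nu[OF K_banach_structure_scaleR that(1) ex_state_real that(2)] .
  show "BPBop_nu ((*\<^sub>R) :: real \<Rightarrow> 'a \<Rightarrow> 'a)"
    if "K_one_dimensional ((*\<^sub>R) :: real \<Rightarrow> 'a \<Rightarrow> 'a)"
    by (rule BPBop_nu_one_dimensional[OF K_banach_structure_scaleR that])
  fix sm :: "complex \<Rightarrow> 'a \<Rightarrow> 'a"
  assume sm: "K_banach_structure sm"
  show "K_one_dimensional sm" if "\<exists>x::'a. x \<noteq> 0" "BPBop_nu sm"
    using one_dimensional_BPBop_nu[OF sm that(1) ex_state_complex[OF sm] that(2)] .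
  show "BPBop_nu sm" if "K_one_dimensional sm"
    by (rule BPBop_nu_one_dimensional[OF sm that])
qed

end
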